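(* Let the energy density $\mu$ be real analytic at $r=0$. Then the analytic solutions of the Tolman--Oppenheimer--Volkoff (TOV) equations about $r=0$ are given by $$\begin{bmatrix} s \\ u \end{bmatrix}=\begin{bmatrix} r & 0 \\ 0 & 1 \end{bmatrix}\mathbb{P}(r)\begin{bmatrix} c_1 \\ c_2 \end{bmatrix},\qquad \mathcal{A}=\frac{r\phi s}{2u},\qquad p=\mathcal{E}+\mathcal{A}\phi-\frac13\mu ,$$ where $c_1,c_2$ are integration constants ($c_2\neq0$) and $\mathbb{P}(r)=\sum_{m=0}^{+\infty}\mathbb{P}_m r^m$ has matrix coefficients given by the recurrence relation $$\mathbb{P}_0=\mathbb{I}_2,\qquad \mathbb{P}_m=\frac1m\sum_{k=0}^{m-1}\widetilde\Theta_{m-1-k}\,\mathbb{P}_k\quad(m\ge1),$$ with $\widetilde\Theta(r)=\sum_{m=0}^{+\infty}\widetilde\Theta_m r^m$ the power series about $r=0$ of $$\widetilde\Theta=\begin{bmatrix} \dfrac{r\left(\mu-\frac{2M}{r^3}\right)}{2\left(1-\frac{2M}{r}\right)} & \dfrac{\mu-\frac{6M}{r^3}}{2r\left(1-\frac{2M}{r}\right)} \\ r & 0 \end{bmatrix}.$$ Moreover, setting $c_2=1$, one has $c_1=\frac16(3p_c+\mu_c)$, where $\mu_c=\mu(0)$ and $p_c=p(0)$.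
   Context: Units $8\pi G=c=1$, cosmological constant $\Lambda=0$. The TOV equations for the pressure $p(r)$, with prescribed energy density $\mu(r)$, are $$\frac{dp}{dr}=-\frac{r^{2}(\mu+p)}{2(r-2M)}\left(p+\frac{2M}{r^{3}}\right),\qquad M(r)=\frac12\int_0^r\mu(x)x^2\,dx ,$$ with $r>2M(r)$. Define $$\phi=\frac{2}{r}\sqrt{1-\frac{2M}{r}},\qquad \mathcal{A}\phi=p+\frac{2M}{r^{3}},\qquad \mathcal{E}=\frac13\mu-\frac{2M}{r^{3}},$$ and let $u$ be a nonvanishing function near $r=0$ with $\frac{2\mathcal{A}}{r\phi}=\frac1u\frac{du}{dr}$, and $s=\frac{du}{dr}$. $\mathbb{I}_2$ is the $2\times2$ identity matrix. *)

theory Defs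
  imports "HOL-Analysis.Analysis"
begin

text \<open>
  The variable r is a radius: the equations are only imposed for r > 0 (for u and s, r \<ge> 0).
  Real analyticity at r = 0 is the library's \<open>has_fps_expansion\<close>, taken over the reals.
\<close>

definition real_analytic_at_0 :: "(real \<Rightarrow> real) \<Rightarrow> bool" where
  "real_analytic_at_0 f \<longleftrightarrow> (\<exists>F. f has_fps_expansion F)"

definition tov_mass :: "(real \<Rightarrow> real) \<Rightarrow> real \<Rightarrow> real" where
  "tov_mass \<mu> r = 1 / 2 * integral {0..r} (\<lambda>x. \<mu> x * x\<^sup>2)"

definition tov_phi :: "(real \<Rightarrow> real) \<Rightarrow> real \<Rightarrow> real" where
  "tov_phi \<mu> r = 2 / r * sqrt (1 - 2 * tov_mass \<mu> r / r)"

definition tov_E :: "(real \<Rightarrow> real) \<Rightarrow> real \<Rightarrow> real" where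
  "tov_E \<mu> r = 1 / 3 * \<mu> r - 2 * tov_mass \<mu> r / r ^ 3"

definition tov_analytic_solution :: "(real \<Rightarrow> real) \<Rightarrow> (real \<Rightarrow> real) \<Rightarrow> bool" where
  "tov_analytic_solution \<mu> p \<longleftrightarrow>
     real_analytic_at_0 p \<and>
     (\<exists>\<delta>>0. \<forall>r\<in>{0<..<\<delta>}.
        r > 2 * tov_mass \<mu> r \<and>
        (p has_real_derivative
           - (r\<^sup>2 * (\<mu> r + p r)) / (2 * (r - 2 * tov_mass \<mu> r))
             * (p r + 2 * tov_mass \<mu> r / r ^ 3)) (at r))"

definition tov_variables ::
    "(real \<Rightarrow> real) \<Rightarrow> (real \<Rightarrow> real) \<Rightarrow> (real \<Rightarrow> real) \<Rightarrow> (real \<Rightarrow> real) \<Rightarrow> (real \<Rightarrow> real) \<Rightarrow> bool" where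
  "tov_variables \<mu> p A u s \<longleftrightarrow>
     (\<exists>\<delta>>0.
        (\<forall>r\<in>{0..<\<delta>}. u r \<noteq> 0 \<and> (u has_real_derivative s r) (at r within {0..})) \<and>
        (\<forall>r\<in>{0<..<\<delta>}.
           A r * tov_phi \<mu> r = p r + 2 * tov_mass \<mu> r / r ^ 3 \<and>
           2 * A r / (r * tov_phi \<mu> r) = 1 / u r * s r))"

definition tov_Theta :: "(real \<Rightarrow> real) \<Rightarrow> real \<Rightarrow> real^2^2" where
  "tov_Theta \<mu> r =
     vector
       [vector [r * (\<mu> r - 2 * tov_mass \<mu> r / r ^ 3) / (2 * (1 - 2 * tov_mass \<mu> r / r)),
                (\<mu> r - 6 * tov_mass \<mu> r / r ^ 3) / (2 * r * (1 - 2 * tov_mass \<mu> r / r))],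
        vector [r, 0]]"

text \<open>
  The formula for \<^const>\<open>tov_Theta\<close> has a removable singularity at r = 0 (division by zero yields 0
  there), so its power series is compared with it for small r > 0 only. This determines \<open>T\<close>.
\<close>

definition Theta_power_series :: "(real \<Rightarrow> real) \<Rightarrow> (nat \<Rightarrow> real^2^2) \<Rightarrow> bool" where
  "Theta_power_series \<mu> T \<longleftrightarrow>
     (\<exists>\<delta>>0. \<forall>r\<in>{0<..<\<delta>}. (\<lambda>m. r ^ m *\<^sub>R T m) sums tov_Theta \<mu> r)"

fun P_coeff :: "(nat \<Rightarrow> real^2^2) \<Rightarrow> nat \<Rightarrow> real^2^2" where
  "P_coeff T m =
     (if m = 0 then mat 1
      else (1 / real m) *\<^sub>R (\<Sum>k<m. T (m - 1 - k) ** P_coeff T k))"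

declare P_coeff.simps [simp del]

definition P_series :: "(nat \<Rightarrow> real^2^2) \<Rightarrow> real \<Rightarrow> real^2^2" where
  "P_series T r = (\<Sum>m. r ^ m *\<^sub>R P_coeff T m)"

definition solution_formula ::
    "(real \<Rightarrow> real) \<Rightarrow> (nat \<Rightarrow> real^2^2) \<Rightarrow> real \<Rightarrow> real \<Rightarrow>
     (real \<Rightarrow> real) \<Rightarrow> (real \<Rightarrow> real) \<Rightarrow> (real \<Rightarrow> real) \<Rightarrow> (real \<Rightarrow> real) \<Rightarrow> bool" where
  "solution_formula \<mu> T c1 c2 p A u s \<longleftrightarrow>
     (\<exists>\<delta>>0.
        (\<forall>r\<in>{0..<\<delta>}.
           (vector [s r, u r] :: real^2) =
             (vector [vector [r, 0], vector [0, 1]] :: real^2^2) *v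
               (P_series T r *v vector [c1, c2])) \<and>
        (\<forall>r\<in>{0<..<\<delta>}.
           A r = r * tov_phi \<mu> r * s r / (2 * u r) \<and>
           p r = tov_E \<mu> r + A r * tov_phi \<mu> r - 1 / 3 * \<mu> r))"

end

theory Submission imports Defs begin

text \<open>
  Write N = 2M/\<open>r\<^sup>3\<close> and D = 1 - \<open>r\<^sup>2\<close> N; both extend analytically through r = 0, and r N' = \<open>\<mu>\<close> - 3 N.
  The substitution p + N = 2 D w / u with u' = r w turns the TOV equation, a Riccati equation, into
  the linear system (w, u)' = \<open>\<Theta>\<close> (w, u) with analytic coefficients, and s = r w. The recurrence for
  the matrix coefficients says that \<open>\<P>\<close>' = \<open>\<Theta> \<P>\<close>; a geometric bound makes the series converge, and
  uniqueness for the linear system shows that every solution is of the form \<open>\<P>\<close> (\<open>c\<^sub>1\<close>, \<open>c\<^sub>2\<close>).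
  Evaluating p + N = 2 D w / u at r = 0, where N = \<open>\<mu>\<close>/3, gives \<open>c\<^sub>1\<close> in terms of the central values.
\<close>

section \<open>Properties of small positive radii, and entrywise convergence\<close>

lemma eventually_at_right_0_iff:
  "eventually P (at_right (0::real)) \<longleftrightarrow> (\<exists>\<delta>>0. \<forall>r\<in>{0<..<\<delta>}. P r)"
  unfolding eventually_at_right_field by (intro iff_exI) auto

lemma ex_ball_Ico_iff:
  "(\<exists>\<delta>>0. \<forall>r\<in>{0..<\<delta>}. P r) \<longleftrightarrow> P 0 \<and> eventually P (at_right (0::real))"
proof -
  have "(\<exists>\<delta>>0. \<forall>r\<in>{0..<\<delta>}. P r) \<longleftrightarrow> (\<exists>\<delta>>0. P 0 \<and> (\<forall>r\<in>{0<..<\<delta>}. P r))"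
  proof (intro iff_exI conj_cong refl)
    fix \<delta> :: real assume "\<delta> > 0"
    then have "{0..<\<delta>} = insert 0 {0<..<\<delta>}" by auto
    then show "(\<forall>r\<in>{0..<\<delta>}. P r) \<longleftrightarrow> P 0 \<and> (\<forall>r\<in>{0<..<\<delta>}. P r)" by simp
  qed
  then show ?thesis
    unfolding eventually_at_right_0_iff by blast
qed

text \<open>Both \<open>solution_formula\<close> and \<open>tov_variables\<close> impose conditions
  on [0, d) and on (0, d) with one common d. Splitting off the value at 0 leaves a property that the
  filter \<open>at_right 0\<close> can carry.\<close>

lemma ex_ball_Ico_Ioo_iff:
  "(\<exists>\<delta>>0. (\<forall>r\<in>{0..<\<delta>}. P r) \<and> (\<forall>r\<in>{0<..<\<delta>}. Q r)) \<longleftrightarrow>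
     P 0 \<and> eventually (\<lambda>r. P r \<and> Q r) (at_right (0::real))"
proof -
  have "(\<exists>\<delta>>0. (\<forall>r\<in>{0..<\<delta>}. P r) \<and> (\<forall>r\<in>{0<..<\<delta>}. Q r)) \<longleftrightarrow>
      (\<exists>\<delta>>0. \<forall>r\<in>{0..<\<delta>}. P r \<and> (r > 0 \<longrightarrow> Q r))"
    by (intro iff_exI) auto
  also have "\<dots> \<longleftrightarrow> P 0 \<and> eventually (\<lambda>r. P r \<and> (r > 0 \<longrightarrow> Q r)) (at_right 0)"
    by (subst ex_ball_Ico_iff) simp
  also have "\<dots> \<longleftrightarrow> P 0 \<and> eventually (\<lambda>r. P r \<and> Q r) (at_right 0)"
    unfolding eventually_at_right_0_iff by auto
  finally show ?thesis .
qed

lemma eventually_at_right_if_nhds: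
  "eventually P (nhds a) \<Longrightarrow> eventually P (at_right a)"
  using at_within_le_nhds filter_leD by blast

text \<open>Every point of an open interval (0, d) is interior to it. Hence an equation between
  functions valid for small r > 0 may be differentiated at each such r.\<close>

lemma eventually_nhds_at_right:
  assumes "eventually P (at_right (0::real))"
  shows "eventually (\<lambda>r. eventually P (nhds r)) (at_right 0)"
proof -
  obtain \<delta> where \<delta>: "\<delta> > 0" "\<And>r. r \<in> {0<..<\<delta>} \<Longrightarrow> P r"
    using assms unfolding eventually_at_right_0_iff by blast
  have "eventually P (nhds r)" if "r \<in> {0<..<\<delta>}" for r
    unfolding eventually_nhds using that \<delta> by (intro exI[of _ "{0<..<\<delta>}"]) auto
  then show ?thesis
    unfolding eventually_at_right_0_iff using \<delta>(1) by blast
qed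

lemma eventually_DERIV_cong_at_right:
  assumes "eventually (\<lambda>r. f r = g r) (at_right (0::real))"
  shows "eventually (\<lambda>r. \<forall>d. (f has_real_derivative d) (at r) \<longleftrightarrow> (g has_real_derivative d) (at r))
    (at_right 0)"
  using eventually_nhds_at_right[OF assms]
  by eventually_elim (auto intro: DERIV_cong_ev[THEN iffD1] DERIV_cong_ev[THEN iffD2])

lemma sums_vecI:
  fixes f :: "nat \<Rightarrow> 'a::real_normed_vector ^ 'n::finite"
  assumes "\<And>i. (\<lambda>n. f n $ i) sums (a $ i)"
  shows "f sums a"
  using assms unfolding sums_def by (intro vec_tendstoI) simp

lemma sums_matrixI:
  fixes f :: "nat \<Rightarrow> real ^ 'n::finite ^ 'm::finite"
  assumes "\<And>i j. (\<lambda>n. f n $ i $ j) sums (a $ i $ j)"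
  shows "f sums a"
  using assms by (intro sums_vecI)

section \<open>Formal power series and their expansions\<close>

text \<open>Integration divides each coefficient by \<open>Suc n\<close>, which is at least 1, so
  the terms at r are dominated by those of \<open>F\<close> times the constant r.\<close>

lemma fps_conv_radius_integral_ge:
  fixes F :: "real fps"
  shows "fps_conv_radius (fps_integral F c) \<ge> fps_conv_radius F"
  unfolding fps_conv_radius_def
proof (rule conv_radius_geI_ex')
  fix r :: real assume r: "0 < r" "ereal r < conv_radius (fps_nth F)"
  have "summable (\<lambda>n. norm (fps_nth F n * r ^ n) * r)"
    using r by (intro summable_mult2 abs_summable_in_conv_radius) auto
  then have "summable (\<lambda>n. fps_nth (fps_integral F c) (Suc n) * r ^ Suc n)"
  proof (rule summable_comparison_test'[where N = 0])
    fix n :: nat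
    have "norm (fps_nth (fps_integral F c) (Suc n) * r ^ Suc n)
        = norm (fps_nth F n * r ^ n) * r * inverse (real (Suc n))"
      using r(1) by (simp add: abs_mult divide_simps)
    also have "\<dots> \<le> norm (fps_nth F n * r ^ n) * r * 1"
      using r(1) by (intro mult_left_mono) (auto simp: divide_simps)
    finally show "norm (fps_nth (fps_integral F c) (Suc n) * r ^ Suc n)
        \<le> norm (fps_nth F n * r ^ n) * r" by simp
  qed
  then show "summable (\<lambda>n. fps_nth (fps_integral F c) n * of_real r ^ n)"
    by (subst summable_Suc_iff[symmetric]) simp
qed

lemma has_fps_expansion_unique_nhds:
  "f has_fps_expansion F \<Longrightarrow> g has_fps_expansion F \<Longrightarrow> eventually (\<lambda>z. f z = g z) (nhds 0)"
  unfolding has_fps_expansion_def by (auto elim: eventually_elim2)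

lemma eventually_in_fps_conv_radius:
  fixes F :: "real fps"
  assumes "fps_conv_radius F > 0"
  shows "eventually (\<lambda>z. ereal \<bar>z\<bar> < fps_conv_radius F) (nhds 0)"
proof -
  have "eventually (\<lambda>z. z \<in> eball 0 (fps_conv_radius F)) (nhds (0::real))"
    using assms by (intro eventually_nhds_in_open) (auto simp: zero_ereal_def)
  then show ?thesis by simp
qed

text \<open>The expansion gives agreement with \<open>eval_fps F\<close> on a neighbourhood of 0,
  hence on a neighbourhood of each z close to 0, and this transfers the derivative of the series to
  f.\<close>

lemma has_fps_expansion_has_real_derivative:
  fixes F :: "real fps"
  assumes "f has_fps_expansion F"
  shows "eventually (\<lambda>z. (f has_real_derivative eval_fps (fps_deriv F) z) (at z)) (nhds 0)"
proof -
  have "eventually (\<lambda>z. eventually (\<lambda>w. eval_fps F w = f w) (nhds z)) (nhds 0)"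
    using assms by (simp add: has_fps_expansion_def eventually_eventually)
  moreover have "eventually (\<lambda>z. ereal \<bar>z\<bar> < fps_conv_radius F) (nhds 0)"
    using assms by (intro eventually_in_fps_conv_radius) (simp add: has_fps_expansion_def)
  ultimately show ?thesis
  proof eventually_elim
    case (elim z)
    then show ?case
      using has_field_derivative_eval_fps[of z F UNIV, simplified] DERIV_cong_ev[OF refl elim(1) refl] by blast
  qed
qed

lemma has_fps_expansion_eval_deriv:
  fixes F :: "real fps"
  assumes "fps_conv_radius F > 0"
  shows "eval_fps (fps_deriv F) has_fps_expansion fps_deriv F"
  using assms fps_conv_radius_deriv[of F] by (intro eval_fps_has_fps_expansion) auto

lemma has_fps_expansion_at_0:
  "f has_fps_expansion F \<Longrightarrow> f 0 = fps_nth F 0"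
  by (auto simp: has_fps_expansion_def eval_fps_at_0 dest: eventually_nhds_x_imp_x)

lemma has_fps_expansion_tendsto_at_right:
  fixes F :: "real fps"
  assumes "f has_fps_expansion F"
  shows "(f \<longlongrightarrow> f 0) (at_right 0)"
  using has_fps_expansion_imp_continuous[OF assms] by (simp add: continuous_within)

text \<open>At some r > 0 inside the radius the terms are bounded by a constant C. Any L above both
  C and 1/r works, the extra factor in \<open>L ^ Suc n\<close> absorbing C. Stating this for all
  large L allows one L to serve several series.\<close>

lemma fps_coeff_geometric_bound:
  fixes F :: "real fps"
  assumes "fps_conv_radius F > 0"
  shows "eventually (\<lambda>L. \<forall>n. \<bar>fps_nth F n\<bar> \<le> L ^ Suc n) at_top"
proof -
  obtain r where r: "0 < r" "ereal r < fps_conv_radius F"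
    using assms ereal_dense2[of 0 "fps_conv_radius F"] by (auto simp: zero_ereal_def)
  have "summable (\<lambda>n. fps_nth F n * r ^ n)"
    using r by (intro summable_fps) simp
  then have "Bseq (\<lambda>n. fps_nth F n * r ^ n)"
    by (intro convergent_imp_Bseq) (use summable_LIMSEQ_zero in \<open>auto simp: convergent_def\<close>)
  then obtain C where C: "C > 0" "\<And>n. \<bar>fps_nth F n * r ^ n\<bar> \<le> C"
    unfolding Bseq_def by auto
  have "\<bar>fps_nth F n\<bar> \<le> L ^ Suc n" if L: "L \<ge> max C (1 / r)" for L n
  proof -
    have "\<bar>fps_nth F n\<bar> = \<bar>fps_nth F n * r ^ n\<bar> * (1 / r) ^ n"
      using r by (simp add: abs_mult power_divide)
    also have "\<dots> \<le> L * L ^ n"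
      using L C(2)[of n] C(1) r(1) by (intro mult_mono power_mono) auto
    finally show ?thesis by simp
  qed
  then show ?thesis
    unfolding eventually_at_top_linorder by blast
qed

section \<open>The matrix power series\<close>

lemma P_coeff_0: "P_coeff T 0 = mat 1"
  by (subst P_coeff.simps) simp

lemma P_coeff_Suc_nth:
  "P_coeff T (Suc n) $ i $ j =
     1 / real (Suc n) * (\<Sum>k\<le>n. (\<Sum>l\<in>UNIV. T (n - k) $ i $ l * P_coeff T k $ l $ j))"
  by (subst P_coeff.simps) (simp add: sum_component matrix_matrix_mult_def lessThan_Suc_atMost)

text \<open>Strong induction on n. The base doubles from L to 2L because each entry of a product of
  2 by 2 matrices is a sum of two terms.\<close>

lemma P_coeff_bound:
  assumes L: "L \<ge> 1" and T: "\<And>n i j. \<bar>T n $ i $ j\<bar> \<le> L ^ Suc n"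
  shows "\<bar>P_coeff T n $ i $ j\<bar> \<le> (2 * L) ^ n"
proof (induction n arbitrary: i j rule: less_induct)
  case (less n)
  show ?case
  proof (cases n)
    case 0
    then show ?thesis by (simp add: P_coeff_0 mat_def)
  next
    case (Suc m)
    have term_le: "\<bar>\<Sum>l\<in>UNIV. T (m - k) $ i $ l * P_coeff T k $ l $ j\<bar> \<le> (2 * L) ^ Suc m"
      if k: "k \<le> m" for k
    proof -
      have le: "\<bar>T (m - k) $ i $ l * P_coeff T k $ l $ j\<bar> \<le> L * (2 * L) ^ m" for l
      proof -
        have "\<bar>T (m - k) $ i $ l * P_coeff T k $ l $ j\<bar> \<le> L ^ Suc (m - k) * (2 * L) ^ k"
          unfolding abs_mult using L k Suc by (intro mult_mono T less.IH) auto
        \<comment> \<open>Only one factor L is kept apart; the sum over the two values of l later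
          turns it into 2L and completes the power \<open>Suc m\<close>.\<close>
        also have "\<dots> \<le> (L * (2 * L) ^ (m - k)) * (2 * L) ^ k"
          using L by (auto intro!: mult_right_mono power_mono)
        also have "\<dots> = L * (2 * L) ^ m"
          using k by (simp only: mult.assoc flip: power_add) simp
        finally show ?thesis .
      qed
      have "\<bar>\<Sum>l\<in>UNIV. T (m - k) $ i $ l * P_coeff T k $ l $ j\<bar>
          \<le> (\<Sum>l\<in>(UNIV::2 set). L * (2 * L) ^ m)"
        by (rule order_trans[OF sum_abs]) (intro sum_mono le)
      then show ?thesis by (simp add: mult.assoc)
    qed
    have "\<bar>\<Sum>k\<le>m. (\<Sum>l\<in>UNIV. T (m - k) $ i $ l * P_coeff T k $ l $ j)\<bar>
        \<le> (\<Sum>k\<le>m. (2 * L) ^ Suc m)"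
      by (rule order_trans[OF sum_abs]) (intro sum_mono term_le, simp)
    \<comment> \<open>The number of summands over k is exactly \<open>Suc m\<close>, which the
      prefactor of the recurrence cancels.\<close>
    then have "\<bar>P_coeff T (Suc m) $ i $ j\<bar> \<le> 1 / real (Suc m) * (real (Suc m) * (2 * L) ^ Suc m)"
      unfolding P_coeff_Suc_nth abs_mult by (intro mult_mono) auto
    then show ?thesis using Suc by simp
  qed
qed

text \<open>Passing to scalar entries makes radius of convergence, Cauchy product and formal
  derivative available for the matrix series.\<close>

definition P_fps :: "(nat \<Rightarrow> real^2^2) \<Rightarrow> 2 \<Rightarrow> 2 \<Rightarrow> real fps" where
  "P_fps T i j = Abs_fps (\<lambda>n. P_coeff T n $ i $ j)"

lemma P_fps_conv_radius_pos:
  assumes "\<And>i j. fps_conv_radius (Abs_fps (\<lambda>n. T n $ i $ j)) > 0"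
  shows "fps_conv_radius (P_fps T i j) > 0"
proof -
  \<comment> \<open>Finitely many eventual bounds hold jointly, which yields a single L for all four
    entries.\<close>
  have "eventually (\<lambda>L. L \<ge> 1 \<and> (\<forall>i\<in>UNIV. \<forall>j\<in>UNIV. \<forall>n. \<bar>T n $ i $ j\<bar> \<le> L ^ Suc n)) at_top"
    using fps_coeff_geometric_bound[OF assms]
    by (intro eventually_conj eventually_ge_at_top eventually_ball_finite ballI) simp_all
  from eventually_happens'[OF trivial_limit_at_top_linorder this]
  obtain L where L: "L \<ge> 1" "\<And>i j n. \<bar>T n $ i $ j\<bar> \<le> L ^ Suc n"
    by blast
  \<comment> \<open>The radius 1/(4L) is half of 1/(2L), so the terms are at most (1/2)^n.\<close>
  have "summable (\<lambda>n. P_coeff T n $ i $ j * (1 / (4 * L)) ^ n)"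
  proof (rule summable_comparison_test'[where N = 0])
    show "summable (\<lambda>n. (1 / 2 :: real) ^ n)" by (simp add: summable_geometric)
    fix n :: nat
    have "norm (P_coeff T n $ i $ j * (1 / (4 * L)) ^ n) \<le> (2 * L) ^ n * (1 / (4 * L)) ^ n"
      using P_coeff_bound[OF L, of n i j] L(1) unfolding real_norm_def abs_mult by (intro mult_mono) auto
    also have "\<dots> = (1 / 2) ^ n"
      using L(1) by (simp only: power_mult_distrib[symmetric]) simp
    finally show "norm (P_coeff T n $ i $ j * (1 / (4 * L)) ^ n) \<le> (1 / 2) ^ n" .
  qed
  then have "ereal (norm (1 / (4 * L))) \<le> fps_conv_radius (P_fps T i j)"
    unfolding fps_conv_radius_def P_fps_def by (intro conv_radius_geI) (simp only: fps_nth_Abs_fps)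
  moreover have "0 < ereal (norm (1 / (4 * L)))" using L(1) by simp
  ultimately show ?thesis by (rule less_le_trans[rotated])
qed

text \<open>The formal derivative multiplies coefficient n + 1 by n + 1, cancelling the prefactor of
  the recurrence; what remains is a Cauchy product. This is the matrix equation P' = Theta P, entry
  by entry.\<close>

lemma fps_deriv_P_fps:
  "fps_deriv (P_fps T i j) = (\<Sum>l\<in>UNIV. Abs_fps (\<lambda>n. T n $ i $ l) * P_fps T l j)"
proof (rule fps_ext)
  fix n
  have "fps_nth (fps_deriv (P_fps T i j)) n
      = (\<Sum>k\<le>n. (\<Sum>l\<in>UNIV. T (n - k) $ i $ l * P_coeff T k $ l $ j))"
    by (simp add: P_fps_def P_coeff_Suc_nth del: of_nat_Suc)
  also have "\<dots> = (\<Sum>l\<in>UNIV. (\<Sum>k\<le>n. P_coeff T k $ l $ j * T (n - k) $ i $ l))"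
    by (subst sum.swap) (simp add: mult.commute)
  also have "\<dots> = fps_nth (\<Sum>l\<in>UNIV. P_fps T l j * Abs_fps (\<lambda>n. T n $ i $ l)) n"
    by (simp add: fps_sum_nth fps_mult_nth P_fps_def atLeast0AtMost)
  finally show "fps_nth (fps_deriv (P_fps T i j)) n
      = fps_nth (\<Sum>l\<in>UNIV. Abs_fps (\<lambda>n. T n $ i $ l) * P_fps T l j) n"
    by (simp add: mult.commute)
qed

lemma P_series_sums:
  assumes "\<And>i j. ereal \<bar>r\<bar> < fps_conv_radius (P_fps T i j)"
  shows "(\<lambda>m. r ^ m *\<^sub>R P_coeff T m) sums (\<chi> i j. eval_fps (P_fps T i j) r)"
proof (rule sums_matrixI)
  fix i j
  show "(\<lambda>n. (r ^ n *\<^sub>R P_coeff T n) $ i $ j) sums (\<chi> i j. eval_fps (P_fps T i j) r) $ i $ j"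
    using sums_eval_fps[of r "P_fps T i j"] assms[of i j] by (simp add: P_fps_def mult.commute)
qed

section \<open>Uniqueness for planar linear systems\<close>

text \<open>Gronwall: \<open>exp (-4 K r) * (x\<^sup>2 + y\<^sup>2)\<close> is nonincreasing when the coefficients are bounded by K.\<close>

lemma linear_system_zero_at_right:
  fixes x y a b c d :: "real \<Rightarrow> real"
  assumes deriv: "eventually (\<lambda>r. (x has_real_derivative a r * x r + b r * y r) (at r) \<and>
      (y has_real_derivative c r * x r + d r * y r) (at r)) (at_right 0)"
    and bdd: "eventually (\<lambda>r. \<bar>a r\<bar> \<le> K \<and> \<bar>b r\<bar> \<le> K \<and> \<bar>c r\<bar> \<le> K \<and> \<bar>d r\<bar> \<le> K) (at_right 0)"
    and lim: "(x \<longlongrightarrow> 0) (at_right 0)" "(y \<longlongrightarrow> 0) (at_right 0)"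
  shows "eventually (\<lambda>r. x r = 0 \<and> y r = 0) (at_right 0)"
proof -
  define e where "e r = exp (- 4 * K * r) * ((x r)\<^sup>2 + (y r)\<^sup>2)" for r
  obtain \<delta> where \<delta>: "\<delta> > 0" and ev: "\<And>r. r \<in> {0<..<\<delta>} \<Longrightarrow>
      (x has_real_derivative a r * x r + b r * y r) (at r) \<and>
      (y has_real_derivative c r * x r + d r * y r) (at r) \<and>
      \<bar>a r\<bar> \<le> K \<and> \<bar>b r\<bar> \<le> K \<and> \<bar>c r\<bar> \<le> K \<and> \<bar>d r\<bar> \<le> K"
    using eventually_conj[OF deriv bdd] unfolding eventually_at_right_0_iff by blast
  have e_deriv: "\<exists>z. (e has_real_derivative z) (at r) \<and> z \<le> 0" if r: "r \<in> {0<..<\<delta>}" for r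
  proof -
    let ?Q = "2 * x r * (a r * x r + b r * y r) + 2 * y r * (c r * x r + d r * y r)"
    have d: "(e has_real_derivative exp (- 4 * K * r) * (?Q - 4 * K * ((x r)\<^sup>2 + (y r)\<^sup>2))) (at r)"
      unfolding e_def using ev[OF r]
      by (auto intro!: derivative_eq_intros simp: algebra_simps power2_eq_square)
    \<comment> \<open>The two mixed terms of \<open>?Q\<close> contribute at most K(x^2 + y^2) each
      and the diagonal terms 2K(x^2 + y^2) together, whence the constant 4K in the exponent.\<close>
    have prod_le: "t * (x r * y r) \<le> K * (((x r)\<^sup>2 + (y r)\<^sup>2) / 2)" if "\<bar>t\<bar> \<le> K" for t
    proof -
      have "\<bar>x r * y r\<bar> \<le> ((x r)\<^sup>2 + (y r)\<^sup>2) / 2"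
        using sum_squares_bound[of "x r" "y r"] sum_squares_bound[of "- x r" "y r"]
        by (simp add: abs_le_iff)
      then have "\<bar>t * (x r * y r)\<bar> \<le> K * (((x r)\<^sup>2 + (y r)\<^sup>2) / 2)"
        unfolding abs_mult[of t] using that by (intro mult_mono) auto
      then show ?thesis by linarith
    qed
    have "a r * (x r)\<^sup>2 \<le> K * (x r)\<^sup>2" "d r * (y r)\<^sup>2 \<le> K * (y r)\<^sup>2"
      using ev[OF r] by (auto intro!: mult_right_mono)
    moreover have "b r * (x r * y r) \<le> K * (((x r)\<^sup>2 + (y r)\<^sup>2) / 2)"
      "c r * (x r * y r) \<le> K * (((x r)\<^sup>2 + (y r)\<^sup>2) / 2)"
      using ev[OF r] by (blast intro: prod_le)+
    ultimately have "?Q \<le> 4 * K * ((x r)\<^sup>2 + (y r)\<^sup>2)"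
      by (simp add: algebra_simps power2_eq_square)
    then have "exp (- 4 * K * r) * (?Q - 4 * K * ((x r)\<^sup>2 + (y r)\<^sup>2)) \<le> 0"
      by (intro mult_nonneg_nonpos) auto
    with d show ?thesis by blast
  qed
  have e_lim: "(e \<longlongrightarrow> exp (- 4 * K * 0) * (0\<^sup>2 + 0\<^sup>2)) (at_right 0)"
    unfolding e_def by (intro tendsto_intros lim)
  have "x r = 0 \<and> y r = 0" if r: "r \<in> {0<..<\<delta>}" for r
  proof -
    \<comment> \<open>Monotonicity on (0, r] bounds \<open>e r\<close> by the limit of e at 0, which
      is 0, although e is a nonnegative function.\<close>
    have "e r \<le> e t" if t: "t \<in> {0<..<r}" for t
      using t r e_deriv by (intro DERIV_nonpos_imp_nonincreasing[of t r e]) auto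
    then have "eventually (\<lambda>t. e r \<le> e t) (at_right 0)"
      unfolding eventually_at_right_0_iff using r by auto
    then have "e r \<le> 0"
      using tendsto_lowerbound[OF e_lim] by simp
    then have "(x r)\<^sup>2 + (y r)\<^sup>2 \<le> 0"
      unfolding e_def by (simp add: mult_le_0_iff)
    then show ?thesis by (simp add: sum_power2_le_zero_iff)
  qed
  then show ?thesis
    unfolding eventually_at_right_0_iff using \<delta> by blast
qed

section \<open>Stellar models with analytic density\<close>

locale analytic_density =
  fixes \<mu> :: "real \<Rightarrow> real" and F :: "real fps"
  assumes mu: "\<mu> has_fps_expansion F"
begin

text \<open>Termwise integration of \<open>\<mu> x * x\<^sup>2\<close> gives F_n r^(n+3) / (n+3) as
  the terms of 2M; division by r^3 leaves these coefficients.\<close>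

definition mean_density_fps :: "real fps" where
  "mean_density_fps = Abs_fps (\<lambda>n. fps_nth F n / real (n + 3))"

text \<open>The analytic extension of 2M/\<open>r\<^sup>3\<close> through r = 0.\<close>

definition N :: "real \<Rightarrow> real" where "N = eval_fps mean_density_fps"

definition N' :: "real \<Rightarrow> real" where "N' = eval_fps (fps_deriv mean_density_fps)"

definition D :: "real \<Rightarrow> real" where "D r = 1 - r\<^sup>2 * N r"

definition D_fps :: "real fps" where "D_fps = 1 - fps_X\<^sup>2 * mean_density_fps"

definition \<theta>\<^sub>1 :: "real \<Rightarrow> real" where "\<theta>\<^sub>1 r = r * (\<mu> r - N r) / (2 * D r)"

text \<open>The upper right entry of Theta has numerator \<open>\<mu> r - 3 * N r\<close>, which
  equals \<open>r * N' r\<close>; cancelling r removes the singularity at 0.\<close>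

definition \<theta>\<^sub>2 :: "real \<Rightarrow> real" where "\<theta>\<^sub>2 r = N' r / (2 * D r)"

text \<open>The divisor \<open>2 * D_fps\<close> has constant coefficient 2, so it is a unit and the
  quotients are the expansions of \<open>\<theta>\<^sub>1\<close> and
  \<open>\<theta>\<^sub>2\<close>.\<close>

definition T :: "nat \<Rightarrow> real^2^2" where
  "T n = vector
     [vector [fps_nth (fps_X * (F - mean_density_fps) / (2 * D_fps)) n,
              fps_nth (fps_deriv mean_density_fps / (2 * D_fps)) n],
      vector [fps_nth fps_X n, 0]]"

text \<open>Serves to show that the series of \<open>N\<close> converges: integration does not
  shrink the radius of convergence and shifting preserves it.\<close>

lemma mean_density_fps_eq_shift:
  "mean_density_fps = fps_shift 3 (fps_integral0 (fps_X\<^sup>2 * F))"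
proof (rule fps_ext)
  fix n
  have "n + 3 = Suc (n + 2)" by simp
  then have "fps_nth (fps_shift 3 (fps_integral0 (fps_X\<^sup>2 * F))) n
      = fps_nth (fps_integral0 (fps_X\<^sup>2 * F)) (Suc (n + 2))"
    by (simp only: fps_shift_nth)
  also have "\<dots> = fps_nth F n / real (n + 3)"
    by (simp add: fps_X_power_mult_nth divide_simps del: of_nat_Suc)
  finally show "fps_nth mean_density_fps n
      = fps_nth (fps_shift 3 (fps_integral0 (fps_X\<^sup>2 * F))) n"
    by (simp add: mean_density_fps_def)
qed

lemma integral_fps_eq: "fps_integral0 (fps_X\<^sup>2 * F) = fps_X ^ 3 * mean_density_fps"
proof (rule fps_ext)
  fix n
  show "fps_nth (fps_integral0 (fps_X\<^sup>2 * F)) n = fps_nth (fps_X ^ 3 * mean_density_fps) n"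
  proof (cases n)
    case (Suc m)
    then show ?thesis
      by (auto simp: fps_X_power_mult_nth mean_density_fps_def divide_simps of_nat_diff)
  qed simp
qed

lemma x2_mu_expansion: "(\<lambda>x. x\<^sup>2 * \<mu> x) has_fps_expansion fps_X\<^sup>2 * F"
  by (intro fps_expansion_intros mu)

lemma integral_conv_radius_pos: "fps_conv_radius (fps_integral0 (fps_X\<^sup>2 * F)) > 0"
  using x2_mu_expansion fps_conv_radius_integral_ge[of "fps_X\<^sup>2 * F" 0]
  by (auto simp: has_fps_expansion_def)

lemma N_expansion: "N has_fps_expansion mean_density_fps"
  unfolding N_def using integral_conv_radius_pos
  by (intro eval_fps_has_fps_expansion) (simp add: mean_density_fps_eq_shift)

lemma N'_expansion: "N' has_fps_expansion fps_deriv mean_density_fps"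
  unfolding N'_def using N_expansion
  by (intro has_fps_expansion_eval_deriv) (simp add: has_fps_expansion_def)

lemma D_expansion: "D has_fps_expansion D_fps"
  unfolding D_def[abs_def] D_fps_def by (intro fps_expansion_intros N_expansion)

lemma D_fps_0: "fps_nth D_fps 0 = 1"
  by (simp add: D_fps_def)

lemma theta1_expansion: "\<theta>\<^sub>1 has_fps_expansion fps_X * (F - mean_density_fps) / (2 * D_fps)"
  unfolding \<theta>\<^sub>1_def[abs_def]
  by (intro fps_expansion_intros mu N_expansion D_expansion) (simp add: D_fps_0)

lemma theta2_expansion: "\<theta>\<^sub>2 has_fps_expansion fps_deriv mean_density_fps / (2 * D_fps)"
  unfolding \<theta>\<^sub>2_def[abs_def]
  by (intro fps_expansion_intros N'_expansion D_expansion) (simp add: D_fps_0)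

lemma N_0: "N 0 = \<mu> 0 / 3"
  using has_fps_expansion_at_0[OF N_expansion] has_fps_expansion_at_0[OF mu]
  by (simp add: mean_density_fps_def)

lemma D_0: "D 0 = 1"
  by (simp add: D_def)

text \<open>On coefficients this is n F_n / (n+3) = F_n - 3 F_n / (n+3).\<close>

lemma N'_eq: "eventually (\<lambda>r. r * N' r = \<mu> r - 3 * N r) (nhds 0)"
proof (rule has_fps_expansion_unique_nhds)
  show "(\<lambda>r. r * N' r) has_fps_expansion fps_X * fps_deriv mean_density_fps"
    by (intro fps_expansion_intros N'_expansion)
  have "fps_X * fps_deriv mean_density_fps = F - 3 * mean_density_fps"
  proof (rule fps_ext)
    fix n
    have "fps_nth (fps_X * fps_deriv mean_density_fps) n = real n * fps_nth mean_density_fps n"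
      by (cases n) simp_all
    also have "\<dots> = fps_nth (F - 3 * mean_density_fps) n"
      by (simp add: mean_density_fps_def numeral_fps_const divide_simps) (simp add: algebra_simps)
    finally show "fps_nth (fps_X * fps_deriv mean_density_fps) n
        = fps_nth (F - 3 * mean_density_fps) n" .
  qed
  moreover have "(\<lambda>r. \<mu> r - 3 * N r) has_fps_expansion F - 3 * mean_density_fps"
    by (intro fps_expansion_intros mu N_expansion)
  ultimately show "(\<lambda>r. \<mu> r - 3 * N r) has_fps_expansion fps_X * fps_deriv mean_density_fps"
    by simp
qed

section \<open>The mass function and the TOV quantities at small positive radii\<close>

lemma tov_mass_eq: "eventually (\<lambda>r. tov_mass \<mu> r = r ^ 3 * N r / 2) (at_right 0)"
proof -
  define g where "g = (\<lambda>r. r ^ 3 * N r)"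
  have g: "g has_fps_expansion fps_integral0 (fps_X\<^sup>2 * F)"
    unfolding integral_fps_eq g_def by (intro fps_expansion_intros N_expansion)
  have "eventually (\<lambda>r. (g has_real_derivative \<mu> r * r\<^sup>2) (at r)) (nhds 0)"
  proof -
    have "eventually (\<lambda>z. eval_fps (fps_X\<^sup>2 * F) z = z\<^sup>2 * \<mu> z) (nhds 0)"
      using x2_mu_expansion by (simp add: has_fps_expansion_def)
    then show ?thesis
      using has_fps_expansion_has_real_derivative[OF g]
      by eventually_elim (simp add: fps_deriv_fps_integral mult.commute)
  qed
  then obtain e where e: "e > 0" "\<And>r. \<bar>r\<bar> < e \<Longrightarrow> (g has_real_derivative \<mu> r * r\<^sup>2) (at r)"
    unfolding eventually_nhds_metric by (auto simp: dist_real_def)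
  have "tov_mass \<mu> r = r ^ 3 * N r / 2" if r: "r \<in> {0<..<e}" for r
  proof -
    \<comment> \<open>Since g vanishes at 0, the fundamental theorem of calculus gives 2M(r) =
      \<open>g r\<close>.\<close>
    have "((\<lambda>x. \<mu> x * x\<^sup>2) has_integral g r - g 0) {0..r}"
      using r e(2)
      by (intro fundamental_theorem_of_calculus)
        (auto simp flip: has_real_derivative_iff_has_vector_derivative
          intro: has_field_derivative_at_within)
    then show ?thesis
      by (simp add: tov_mass_def g_def integral_unique)
  qed
  then show ?thesis
    unfolding eventually_at_right_0_iff using e(1) by blast
qed

text \<open>Collects what holds at all sufficiently small r > 0, so that the translation of the TOV
  quantities becomes algebra at a single radius.\<close>

definition regular :: "real \<Rightarrow> bool" where
  "regular r \<longleftrightarrow> r > 0 \<and> tov_mass \<mu> r = r ^ 3 * N r / 2 \<and> D r > 0 \<and>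
     (N has_real_derivative N' r) (at r) \<and> r * N' r = \<mu> r - 3 * N r"

lemma eventually_regular: "eventually regular (at_right 0)"
proof -
  have "eventually (\<lambda>r. D r > 0) (at_right 0)"
    using has_fps_expansion_tendsto_at_right[OF D_expansion]
    by (rule order_tendstoD) (simp add: D_0)
  moreover have "eventually (\<lambda>r. (N has_real_derivative N' r) (at r)) (at_right 0)"
    unfolding N'_def
    by (rule eventually_at_right_if_nhds[OF has_fps_expansion_has_real_derivative[OF N_expansion]])
  ultimately show ?thesis
    using eventually_at_right_less[of "0::real"] tov_mass_eq eventually_at_right_if_nhds[OF N'_eq]
    by eventually_elim (simp add: regular_def)
qed

context
  fixes r :: real
  assumes r: "regular r"
begin

lemma regular_pos: "r > 0" and regular_D_pos: "D r > 0"
  using r by (auto simp: regular_def)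

lemma regular_mu: "\<mu> r = r * N' r + 3 * N r"
  using r by (simp add: regular_def)

lemma regular_mass_div: "2 * tov_mass \<mu> r / r = r\<^sup>2 * N r"
  "2 * tov_mass \<mu> r / r ^ 3 = N r" "6 * tov_mass \<mu> r / r ^ 3 = 3 * N r"
  "r - 2 * tov_mass \<mu> r = r * D r"
  using r by (auto simp: regular_def D_def field_simps power2_eq_square power3_eq_cube)

lemma regular_mass_less: "r > 2 * tov_mass \<mu> r"
  using regular_mass_div(4) mult_pos_pos[OF regular_pos regular_D_pos] by linarith

lemma regular_phi_square: "(tov_phi \<mu> r)\<^sup>2 = 4 * D r / r\<^sup>2"
  using regular_D_pos by (simp add: tov_phi_def regular_mass_div D_def power_divide power_mult_distrib)

lemma regular_phi_pos: "tov_phi \<mu> r > 0"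
  using regular_D_pos regular_pos by (simp add: tov_phi_def regular_mass_div D_def)

text \<open>With x = w/u, p + N = 2 D w/u and s = r w, this converts A = (p + N)/phi into A = r phi
  s/(2u). It rests on phi^2 = 4D/r^2.\<close>

lemma regular_div_phi: "2 * D r * x / tov_phi \<mu> r = r * tov_phi \<mu> r * (r * x) / 2"
proof -
  have "2 * D r = r\<^sup>2 * (tov_phi \<mu> r)\<^sup>2 / 2"
    unfolding regular_phi_square using regular_pos by simp
  then show ?thesis
    unfolding \<open>2 * D r = _\<close> using regular_phi_pos by (simp add: power2_eq_square)
qed

lemma regular_E: "tov_E \<mu> r = \<mu> r / 3 - N r"
  by (simp add: tov_E_def regular_mass_div)

lemma regular_Theta: "tov_Theta \<mu> r = vector [vector [\<theta>\<^sub>1 r, \<theta>\<^sub>2 r], vector [r, 0]]"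
proof -
  have "(\<mu> r - 3 * N r) / (2 * r * D r) = N' r / (2 * D r)"
    using regular_pos regular_D_pos by (simp add: regular_mu)
  then show ?thesis
    by (simp add: tov_Theta_def regular_mass_div \<theta>\<^sub>1_def \<theta>\<^sub>2_def flip: D_def)
qed

lemma regular_tov_rhs:
  "- (r\<^sup>2 * (\<mu> r + p)) / (2 * (r - 2 * tov_mass \<mu> r)) * (p + 2 * tov_mass \<mu> r / r ^ 3)
    = - (r * (\<mu> r + p) * (p + N r)) / (2 * D r)"
  unfolding regular_mass_div using regular_pos regular_D_pos
  by (simp add: field_simps power2_eq_square)

lemma regular_N_deriv: "(N has_real_derivative N' r) (at r)"
  using r by (simp add: regular_def)

text \<open>The relation r N' = mu - 3 N turns -2 r N - r^2 N' into r (N - mu), which is free of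
  N'.\<close>

lemma regular_D_deriv: "(D has_real_derivative r * (N r - \<mu> r)) (at r)"
proof -
  have "(D has_real_derivative - (2 * r * N r + r * (r * N' r))) (at r)"
    unfolding D_def[abs_def]
    by (auto intro!: derivative_eq_intros regular_N_deriv simp: power2_eq_square algebra_simps)
  also have "- (2 * r * N r + r * (r * N' r)) = r * (N r - \<mu> r)"
    by (simp add: regular_mu algebra_simps)
  finally show ?thesis .
qed

end

section \<open>The power series of Theta and the linear system solved by P(r) (c1, c2)\<close>

lemma T_fps:
  "Abs_fps (\<lambda>n. T n $ 1 $ 1) = fps_X * (F - mean_density_fps) / (2 * D_fps)"
  "Abs_fps (\<lambda>n. T n $ 1 $ 2) = fps_deriv mean_density_fps / (2 * D_fps)"
  "Abs_fps (\<lambda>n. T n $ 2 $ 1) = fps_X"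
  "Abs_fps (\<lambda>n. T n $ 2 $ 2) = 0"
  by (simp_all add: T_def fps_eq_iff del: fps_X_nth)

lemma T_conv_radius_pos: "fps_conv_radius (Abs_fps (\<lambda>n. T n $ i $ j)) > 0"
  using theta1_expansion theta2_expansion exhaust_2[of i] exhaust_2[of j]
  by (auto simp: T_fps has_fps_expansion_def)

lemma Theta_power_series_T: "Theta_power_series \<mu> T"
proof -
  let ?f = "\<lambda>i j. Abs_fps (\<lambda>n. T n $ i $ j)"
  have sums: "eventually (\<lambda>r. (\<lambda>n. T n $ i $ j * r ^ n) sums eval_fps (?f i j) r) (nhds 0)" for i j
    using eventually_in_fps_conv_radius[OF T_conv_radius_pos[of i j]]
  proof eventually_elim
    case (elim r)
    then show ?case using sums_eval_fps[of r "?f i j"] by simp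
  qed
  have "eventually (\<lambda>r. \<forall>i\<in>UNIV. \<forall>j\<in>UNIV.
      (\<lambda>n. T n $ i $ j * r ^ n) sums eval_fps (?f i j) r) (at_right 0)"
    by (intro eventually_at_right_if_nhds eventually_ball_finite ballI sums) simp_all
  moreover have "eventually (\<lambda>r. eval_fps (?f 1 1) r = \<theta>\<^sub>1 r) (at_right 0)"
    "eventually (\<lambda>r. eval_fps (?f 1 2) r = \<theta>\<^sub>2 r) (at_right 0)"
    using theta1_expansion theta2_expansion unfolding T_fps has_fps_expansion_def
    by (auto intro: eventually_at_right_if_nhds)
  ultimately have "eventually (\<lambda>r. (\<lambda>n. r ^ n *\<^sub>R T n) sums tov_Theta \<mu> r) (at_right 0)"
    using eventually_regular
  proof eventually_elim
    case (elim r)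
    have "tov_Theta \<mu> r $ i $ j = eval_fps (?f i j) r" for i j
      using exhaust_2[of i] exhaust_2[of j] elim(2,3) T_fps(3,4) regular_Theta[OF elim(4)] by auto
    then show ?case
      using elim(1) by (intro sums_matrixI) (simp add: mult.commute)
  qed
  then show ?thesis
    unfolding Theta_power_series_def eventually_at_right_0_iff .
qed

lemma P_series_sums_nhds:
  "eventually (\<lambda>r. (\<lambda>m. r ^ m *\<^sub>R P_coeff T m) sums (\<chi> i j. eval_fps (P_fps T i j) r)) (nhds 0)"
proof -
  have "eventually (\<lambda>r. \<forall>i\<in>UNIV. \<forall>j\<in>UNIV. ereal \<bar>r\<bar> < fps_conv_radius (P_fps T i j)) (nhds (0::real))"
    by (intro eventually_ball_finite ballI eventually_in_fps_conv_radius
        P_fps_conv_radius_pos T_conv_radius_pos) simp_all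
  then show ?thesis
    by eventually_elim (intro P_series_sums, simp)
qed

lemma P_series_eq: "eventually (\<lambda>r. P_series T r = (\<chi> i j. eval_fps (P_fps T i j) r)) (nhds 0)"
  using P_series_sums_nhds by eventually_elim (simp add: P_series_def sums_iff)

text \<open>\<open>W\<close> and \<open>U\<close> are the components of P(r) (c1, c2) before the
  factor diag(r, 1) is applied, so s corresponds to r W and u to U.\<close>

definition W :: "real \<Rightarrow> real \<Rightarrow> real \<Rightarrow> real" where
  "W c1 c2 r = c1 * eval_fps (P_fps T 1 1) r + c2 * eval_fps (P_fps T 1 2) r"

definition U :: "real \<Rightarrow> real \<Rightarrow> real \<Rightarrow> real" where
  "U c1 c2 r = c1 * eval_fps (P_fps T 2 1) r + c2 * eval_fps (P_fps T 2 2) r"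

definition W_fps :: "real \<Rightarrow> real \<Rightarrow> real fps" where
  "W_fps c1 c2 = fps_const c1 * P_fps T 1 1 + fps_const c2 * P_fps T 1 2"

definition U_fps :: "real \<Rightarrow> real \<Rightarrow> real fps" where
  "U_fps c1 c2 = fps_const c1 * P_fps T 2 1 + fps_const c2 * P_fps T 2 2"

lemma P_expansion: "eval_fps (P_fps T i j) has_fps_expansion P_fps T i j"
  by (intro eval_fps_has_fps_expansion P_fps_conv_radius_pos T_conv_radius_pos)

lemma W_expansion: "W c1 c2 has_fps_expansion W_fps c1 c2"
  unfolding W_def[abs_def] W_fps_def by (intro fps_expansion_intros P_expansion)

lemma U_expansion: "U c1 c2 has_fps_expansion U_fps c1 c2"
  unfolding U_def[abs_def] U_fps_def by (intro fps_expansion_intros P_expansion)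

lemma W_0: "W c1 c2 0 = c1" and U_0: "U c1 c2 0 = c2"
  by (simp_all add: W_def U_def eval_fps_at_0 P_fps_def P_coeff_0 mat_def)

text \<open>First row of P' = Theta P applied to (c1, c2): equal formal series give functions that
  agree near 0.\<close>

lemma W_deriv:
  "eventually (\<lambda>r. (W c1 c2 has_real_derivative \<theta>\<^sub>1 r * W c1 c2 r + \<theta>\<^sub>2 r * U c1 c2 r) (at r)) (nhds 0)"
proof -
  have "fps_deriv (W_fps c1 c2) = fps_X * (F - mean_density_fps) / (2 * D_fps) * W_fps c1 c2
      + fps_deriv mean_density_fps / (2 * D_fps) * U_fps c1 c2"
    by (simp add: W_fps_def U_fps_def fps_deriv_P_fps sum_2 T_fps algebra_simps)
  moreover have "(\<lambda>r. \<theta>\<^sub>1 r * W c1 c2 r + \<theta>\<^sub>2 r * U c1 c2 r) has_fps_expansion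
      fps_X * (F - mean_density_fps) / (2 * D_fps) * W_fps c1 c2
      + fps_deriv mean_density_fps / (2 * D_fps) * U_fps c1 c2"
    by (intro has_fps_expansion_add has_fps_expansion_mult W_expansion U_expansion
        theta1_expansion theta2_expansion)
  ultimately have "eventually (\<lambda>r. eval_fps (fps_deriv (W_fps c1 c2)) r
      = \<theta>\<^sub>1 r * W c1 c2 r + \<theta>\<^sub>2 r * U c1 c2 r) (nhds 0)"
    by (simp add: has_fps_expansion_def)
  then show ?thesis
    using has_fps_expansion_has_real_derivative[OF W_expansion[of c1 c2]]
    by eventually_elim simp
qed

lemma U_deriv: "eventually (\<lambda>r. (U c1 c2 has_real_derivative r * W c1 c2 r) (at r)) (nhds 0)"
proof -
  have "fps_deriv (U_fps c1 c2) = fps_X * W_fps c1 c2"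
    by (simp add: W_fps_def U_fps_def fps_deriv_P_fps sum_2 T_fps algebra_simps)
  moreover have "(\<lambda>r. r * W c1 c2 r) has_fps_expansion fps_X * W_fps c1 c2"
    by (intro fps_expansion_intros W_expansion)
  ultimately have "eventually (\<lambda>r. eval_fps (fps_deriv (U_fps c1 c2)) r = r * W c1 c2 r) (nhds 0)"
    by (simp add: has_fps_expansion_def)
  then show ?thesis
    using has_fps_expansion_has_real_derivative[OF U_expansion[of c1 c2]]
    by eventually_elim simp
qed

section \<open>The three predicates rewritten through N, D, W and U\<close>

lemma solution_formula_iff:
  "solution_formula \<mu> T c1 c2 p A u s \<longleftrightarrow> s 0 = 0 \<and> u 0 = c2 \<and>
     eventually (\<lambda>r. s r = r * W c1 c2 r \<and> u r = U c1 c2 r \<and>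
       A r = r * tov_phi \<mu> r * s r / (2 * u r) \<and>
       p r = 2 * D r * W c1 c2 r / U c1 c2 r - N r) (at_right 0)"
proof -
  let ?L = "\<lambda>r. (vector [s r, u r] :: real^2) =
    (vector [vector [r, 0], vector [0, 1]] :: real^2^2) *v (P_series T r *v vector [c1, c2])"
  have L_iff: "?L r \<longleftrightarrow> s r = r * W c1 c2 r \<and> u r = U c1 c2 r"
    if "P_series T r = (\<chi> i j. eval_fps (P_fps T i j) r)" for r
    unfolding that by (simp add: vec_eq_iff forall_2 matrix_vector_mult_def sum_2 W_def U_def mult.commute)
  \<comment> \<open>At r = 0 the diagonal factor annihilates the first component, and the constant
    coefficient of P is the identity.\<close>
  have "?L 0 \<longleftrightarrow> s 0 = 0 \<and> u 0 = c2"
    using L_iff[of 0] eventually_nhds_x_imp_x[OF P_series_eq] by (simp add: U_0)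
  moreover have "eventually (\<lambda>r. ?L r \<and> A r = r * tov_phi \<mu> r * s r / (2 * u r) \<and>
          p r = tov_E \<mu> r + A r * tov_phi \<mu> r - 1 / 3 * \<mu> r) (at_right 0) \<longleftrightarrow>
      eventually (\<lambda>r. s r = r * W c1 c2 r \<and> u r = U c1 c2 r \<and>
       A r = r * tov_phi \<mu> r * s r / (2 * u r) \<and>
       p r = 2 * D r * W c1 c2 r / U c1 c2 r - N r) (at_right 0)"
  proof (rule eventually_subst)
    show "eventually (\<lambda>r. (?L r \<and> A r = r * tov_phi \<mu> r * s r / (2 * u r) \<and>
          p r = tov_E \<mu> r + A r * tov_phi \<mu> r - 1 / 3 * \<mu> r) =
      (s r = r * W c1 c2 r \<and> u r = U c1 c2 r \<and>
       A r = r * tov_phi \<mu> r * s r / (2 * u r) \<and>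
       p r = 2 * D r * W c1 c2 r / U c1 c2 r - N r)) (at_right 0)"
      using eventually_regular eventually_at_right_if_nhds[OF P_series_eq]
    proof eventually_elim
      case (elim r)
      \<comment> \<open>Multiplying the formula for A by phi brings in phi^2 = 4D/r^2; together with
        E - mu/3 = -N this gives p = 2 D W/U - N.\<close>
      have "A r * tov_phi \<mu> r = 2 * D r * W c1 c2 r / U c1 c2 r"
        if "A r = r * tov_phi \<mu> r * s r / (2 * u r)" "s r = r * W c1 c2 r" "u r = U c1 c2 r"
      proof -
        have "A r * tov_phi \<mu> r = r * (tov_phi \<mu> r)\<^sup>2 * s r / (2 * u r)"
          unfolding that(1) by (simp add: power2_eq_square)
        also have "\<dots> = 2 * D r * W c1 c2 r / U c1 c2 r"
          unfolding regular_phi_square[OF elim(1)] that(2,3)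
          using regular_pos[OF elim(1)] by (simp add: power2_eq_square)
        finally show ?thesis .
      qed
      then show ?case
        unfolding L_iff[OF elim(2)] regular_E[OF elim(1)] by auto
    qed
  qed
  ultimately show ?thesis
    unfolding solution_formula_def ex_ball_Ico_Ioo_iff by simp
qed

text \<open>The inequality r > 2M holds at every regular radius because r - 2M = r D with D > 0, and
  the same factorization simplifies the right-hand side.\<close>

lemma tov_analytic_solution_iff:
  "tov_analytic_solution \<mu> p \<longleftrightarrow> real_analytic_at_0 p \<and>
     eventually (\<lambda>r. (p has_real_derivative - (r * (\<mu> r + p r) * (p r + N r)) / (2 * D r)) (at r))
       (at_right 0)"
proof -
  have "eventually (\<lambda>r. (r > 2 * tov_mass \<mu> r \<and> (p has_real_derivative
          - (r\<^sup>2 * (\<mu> r + p r)) / (2 * (r - 2 * tov_mass \<mu> r))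
             * (p r + 2 * tov_mass \<mu> r / r ^ 3)) (at r)) =
      (p has_real_derivative - (r * (\<mu> r + p r) * (p r + N r)) / (2 * D r)) (at r)) (at_right 0)"
    using eventually_regular
    by eventually_elim (simp only: regular_mass_less regular_tov_rhs simp_thms)
  then show ?thesis
    unfolding tov_analytic_solution_def eventually_at_right_0_iff[symmetric]
    by (intro conj_cong refl eventually_subst)
qed

lemma tov_variables_iff:
  "tov_variables \<mu> p A u s \<longleftrightarrow> u 0 \<noteq> 0 \<and> (u has_real_derivative s 0) (at_right 0) \<and>
     eventually (\<lambda>r. u r \<noteq> 0 \<and> (u has_real_derivative s r) (at r) \<and>
       A r = (p r + N r) / tov_phi \<mu> r \<and> 2 * D r * s r = r * (p r + N r) * u r) (at_right 0)"
proof -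
  have "eventually (\<lambda>r. (u r \<noteq> 0 \<and> (u has_real_derivative s r) (at r within {0..})) \<and>
          A r * tov_phi \<mu> r = p r + 2 * tov_mass \<mu> r / r ^ 3 \<and>
          2 * A r / (r * tov_phi \<mu> r) = 1 / u r * s r) (at_right 0) \<longleftrightarrow>
      eventually (\<lambda>r. u r \<noteq> 0 \<and> (u has_real_derivative s r) (at r) \<and>
       A r = (p r + N r) / tov_phi \<mu> r \<and> 2 * D r * s r = r * (p r + N r) * u r) (at_right 0)"
  proof (rule eventually_subst)
    show "eventually (\<lambda>r. ((u r \<noteq> 0 \<and> (u has_real_derivative s r) (at r within {0..})) \<and>
          A r * tov_phi \<mu> r = p r + 2 * tov_mass \<mu> r / r ^ 3 \<and>
          2 * A r / (r * tov_phi \<mu> r) = 1 / u r * s r) =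
       (u r \<noteq> 0 \<and> (u has_real_derivative s r) (at r) \<and>
       A r = (p r + N r) / tov_phi \<mu> r \<and> 2 * D r * s r = r * (p r + N r) * u r)) (at_right 0)"
      using eventually_regular
    proof eventually_elim
      case (elim r)
      note pos = regular_pos[OF elim] regular_D_pos[OF elim] regular_phi_pos[OF elim]
      \<comment> \<open>A positive radius is interior to the half line, so the derivative is
        one-sided at 0 only.\<close>
      have at: "at r within {0..} = at r"
        using pos(1) by (intro at_within_interior) (simp add: interior_real_atLeast)
      have A: "A r * tov_phi \<mu> r = p r + N r \<longleftrightarrow> A r = (p r + N r) / tov_phi \<mu> r"
        using pos(3) by (auto simp: field_simps)
      have "2 * A r / (r * tov_phi \<mu> r) = 1 / u r * s r \<longleftrightarrow> 2 * D r * s r = r * (p r + N r) * u r"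
        if "A r = (p r + N r) / tov_phi \<mu> r" "u r \<noteq> 0"
      proof -
        have "2 * A r / (r * tov_phi \<mu> r) = 2 * (p r + N r) / (r * (tov_phi \<mu> r)\<^sup>2)"
          unfolding that(1) by (simp add: power2_eq_square)
        also have "\<dots> = r * (p r + N r) / (2 * D r)"
          unfolding regular_phi_square[OF elim] using pos by (simp add: field_simps power2_eq_square)
        finally have eq: "2 * A r / (r * tov_phi \<mu> r) = r * (p r + N r) / (2 * D r)" .
        show ?thesis
          unfolding eq using pos(2) that(2) frac_eq_eq[of "2 * D r" "u r" "r * (p r + N r)" "s r"]
          by (auto simp: mult.commute)
      qed
      then show ?case
        unfolding at regular_mass_div(2)[OF elim] A by blast
    qed
  qed
  then show ?thesis
    unfolding tov_variables_def ex_ball_Ico_Ioo_iff at_within_Ici_at_right by simp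
qed

section \<open>From the series formula to solutions of the TOV equation\<close>

lemma U_nonzero: "c2 \<noteq> 0 \<Longrightarrow> eventually (\<lambda>r. U c1 c2 r \<noteq> 0) (at_right 0)"
  using has_fps_expansion_tendsto_at_right[OF U_expansion[of c1 c2]]
  by (rule tendsto_imp_eventually_ne) (simp add: U_0)

lemma has_derivative_at_right_0_cong:
  fixes f g :: "real \<Rightarrow> real"
  assumes "eventually (\<lambda>r. f r = g r) (at_right 0)" "f 0 = g 0"
  shows "(f has_real_derivative d) (at_right 0) \<longleftrightarrow> (g has_real_derivative d) (at_right 0)"
  unfolding has_field_derivative_iff
  using assms by (intro tendsto_cong) (auto elim: eventually_mono)

lemma U_deriv_0: "(U c1 c2 has_real_derivative 0) (at_right 0)"
  using eventually_nhds_x_imp_x[OF U_deriv[of c1 c2]]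
  by (auto intro: has_field_derivative_at_within)

text \<open>The left side is the quotient rule for 2 D w/u - N with D', w' and u' inserted, the
  right side the TOV expression for this p; m, n, n', d stand for mu, N, N', D.\<close>

lemma formula_derivative_identity:
  fixes r m n n' d u w :: real
  assumes "d \<noteq> 0" "u \<noteq> 0"
  shows "((2 * (r * (n - m)) * w + 2 * d * (r * (m - n) / (2 * d) * w + n' / (2 * d) * u)) * u
      - 2 * d * w * (r * w)) / (u * u) - n' =
    - (r * (m + (2 * d * w / u - n)) * (2 * d * w / u - n + n)) / (2 * d)"
  using assms by (simp add: divide_simps) (simp add: algebra_simps)

lemma formula_imp_tov:
  assumes c2: "c2 \<noteq> 0" and p: "real_analytic_at_0 p"
    and formula: "solution_formula \<mu> T c1 c2 p A u s"
  shows "tov_analytic_solution \<mu> p" "tov_variables \<mu> p A u s"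
proof -
  from formula have s0: "s 0 = 0" and u0: "u 0 = c2" and ev: "eventually (\<lambda>r.
      s r = r * W c1 c2 r \<and> u r = U c1 c2 r \<and> A r = r * tov_phi \<mu> r * s r / (2 * u r) \<and>
      p r = 2 * D r * W c1 c2 r / U c1 c2 r - N r) (at_right 0)"
    unfolding solution_formula_iff by auto
  have p_ev: "eventually (\<lambda>r. p r = 2 * D r * W c1 c2 r / U c1 c2 r - N r) (at_right 0)"
    and u_ev: "eventually (\<lambda>r. u r = U c1 c2 r) (at_right 0)"
    using ev by (auto elim: eventually_mono)
  have "eventually (\<lambda>r. (p has_real_derivative - (r * (\<mu> r + p r) * (p r + N r)) / (2 * D r)) (at r))
      (at_right 0)"
    using eventually_DERIV_cong_at_right[OF p_ev] p_ev eventually_regular U_nonzero[OF c2, of c1]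
      eventually_at_right_if_nhds[OF W_deriv[of c1 c2]]
      eventually_at_right_if_nhds[OF U_deriv[of c1 c2]]
  proof eventually_elim
    case (elim r)
    have D: "D r \<noteq> 0" using regular_D_pos[OF elim(3)] by simp
    have "((\<lambda>r. 2 * D r * W c1 c2 r / U c1 c2 r - N r) has_real_derivative
        ((2 * (r * (N r - \<mu> r)) * W c1 c2 r
          + 2 * D r * (\<theta>\<^sub>1 r * W c1 c2 r + \<theta>\<^sub>2 r * U c1 c2 r)) * U c1 c2 r
        - 2 * D r * W c1 c2 r * (r * W c1 c2 r)) / (U c1 c2 r * U c1 c2 r) - N' r) (at r)"
      using elim(4)
      by (auto intro!: derivative_eq_intros regular_D_deriv[OF elim(3)]
          regular_N_deriv[OF elim(3)] elim(5,6))
    also have "((2 * (r * (N r - \<mu> r)) * W c1 c2 r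
          + 2 * D r * (\<theta>\<^sub>1 r * W c1 c2 r + \<theta>\<^sub>2 r * U c1 c2 r)) * U c1 c2 r
        - 2 * D r * W c1 c2 r * (r * W c1 c2 r)) / (U c1 c2 r * U c1 c2 r) - N' r
        = - (r * (\<mu> r + p r) * (p r + N r)) / (2 * D r)"
      unfolding \<theta>\<^sub>1_def \<theta>\<^sub>2_def elim(2) by (rule formula_derivative_identity[OF D elim(4)])
    finally show ?case
      using elim(1) by blast
  qed
  with p show "tov_analytic_solution \<mu> p"
    unfolding tov_analytic_solution_iff by blast
  \<comment> \<open>Here u agrees with \<open>U\<close> at 0 and to its right, and U' = r W vanishes
    at 0, as s does.\<close>
  have "(u has_real_derivative s 0) (at_right 0)"
    using has_derivative_at_right_0_cong[OF u_ev] U_deriv_0 by (simp add: u0 U_0 s0)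
  moreover have "eventually (\<lambda>r. u r \<noteq> 0 \<and> (u has_real_derivative s r) (at r) \<and>
       A r = (p r + N r) / tov_phi \<mu> r \<and> 2 * D r * s r = r * (p r + N r) * u r) (at_right 0)"
    using eventually_DERIV_cong_at_right[OF u_ev] ev eventually_regular U_nonzero[OF c2, of c1]
      eventually_at_right_if_nhds[OF U_deriv[of c1 c2]]
  proof eventually_elim
    case (elim r)
    have q: "p r + N r = 2 * D r * W c1 c2 r / U c1 c2 r" using elim(2) by simp
    have "A r = (p r + N r) / tov_phi \<mu> r"
      unfolding q using elim(2) regular_div_phi[OF elim(3), of "W c1 c2 r / U c1 c2 r"] by simp
    moreover have "2 * D r * s r = r * (p r + N r) * u r"
      unfolding q using elim(2,4) by simp
    ultimately show ?case
      using elim(1,2,4,5) by simp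
  qed
  ultimately show "tov_variables \<mu> p A u s"
    unfolding tov_variables_iff using c2 u0 by simp
qed

section \<open>From solutions of the TOV equation to the series formula\<close>

lemma tov_derivative_identity:
  fixes r m n n' d p u :: real
  assumes "d \<noteq> 0"
  shows "(((- (r * (m + p) * (p + n)) / (2 * d) + n') * u
        + r * ((p + n) * u / (2 * d)) * (p + n)) * (2 * d)
      - (p + n) * u * (2 * (r * (n - m)))) / (2 * d * (2 * d)) =
    r * (m - n) / (2 * d) * ((p + n) * u / (2 * d)) + n' / (2 * d) * u"
  using assms by (simp add: divide_simps) (simp add: algebra_simps)

lemma coefficients_bounded:
  "\<exists>K. eventually (\<lambda>r. \<bar>\<theta>\<^sub>1 r\<bar> \<le> K \<and> \<bar>\<theta>\<^sub>2 r\<bar> \<le> K \<and> \<bar>r\<bar> \<le> K \<and> \<bar>0::real\<bar> \<le> K) (at_right 0)"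
proof -
  \<comment> \<open>The summand 1 makes K exceed the limits of both coefficients strictly and also
    bounds r on (0, 1).\<close>
  define K where "K = \<bar>\<theta>\<^sub>1 0\<bar> + \<bar>\<theta>\<^sub>2 0\<bar> + 1"
  have "eventually (\<lambda>r. \<bar>\<theta>\<^sub>1 r\<bar> < K) (at_right 0)"
    using tendsto_rabs[OF has_fps_expansion_tendsto_at_right[OF theta1_expansion]]
    by (rule order_tendstoD) (simp add: K_def)
  moreover have "eventually (\<lambda>r. \<bar>\<theta>\<^sub>2 r\<bar> < K) (at_right 0)"
    using tendsto_rabs[OF has_fps_expansion_tendsto_at_right[OF theta2_expansion]]
    by (rule order_tendstoD) (simp add: K_def)
  moreover have "eventually (\<lambda>r. r \<in> {0<..<1}) (at_right (0::real))"
    by (rule eventually_at_right_real) simp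
  ultimately have "eventually (\<lambda>r. \<bar>\<theta>\<^sub>1 r\<bar> \<le> K \<and> \<bar>\<theta>\<^sub>2 r\<bar> \<le> K \<and> \<bar>r\<bar> \<le> K \<and> \<bar>0::real\<bar> \<le> K)
      (at_right 0)"
    by eventually_elim (auto simp: K_def)
  then show ?thesis ..
qed

text \<open>The pair (w, u) solves the same linear system as (\<open>W\<close>, \<open>U\<close>)
  with the same limits at 0. The difference is a solution with zero initial data, so it vanishes for
  small r > 0.\<close>

lemma tov_imp_formula:
  assumes sol: "tov_analytic_solution \<mu> p" and vars: "tov_variables \<mu> p A u s"
  shows "u 0 \<noteq> 0 \<and> solution_formula \<mu> T ((p 0 + N 0) * u 0 / 2) (u 0) p A u s"
proof -
  \<comment> \<open>This is the limit at 0 of the function w defined below, since D is 1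
    there.\<close>
  define c1 where "c1 = (p 0 + N 0) * u 0 / 2"
  define c2 where "c2 = u 0"
  define w where "w r = (p r + N r) * u r / (2 * D r)" for r
  from sol obtain P where p: "p has_fps_expansion P"
    and p_deriv: "eventually (\<lambda>r. (p has_real_derivative
      - (r * (\<mu> r + p r) * (p r + N r)) / (2 * D r)) (at r)) (at_right 0)"
    unfolding tov_analytic_solution_iff real_analytic_at_0_def by blast
  from vars have u0: "u 0 \<noteq> 0" and u_deriv0: "(u has_real_derivative s 0) (at_right 0)"
    and ev: "eventually (\<lambda>r. u r \<noteq> 0 \<and> (u has_real_derivative s r) (at r) \<and>
       A r = (p r + N r) / tov_phi \<mu> r \<and> 2 * D r * s r = r * (p r + N r) * u r) (at_right 0)"
    unfolding tov_variables_iff by auto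
  have s_eq: "eventually (\<lambda>r. s r = r * w r) (at_right 0)"
    using ev eventually_regular
  proof eventually_elim
    case (elim r)
    then show ?case
      using regular_D_pos[OF elim(2)] by (auto simp: w_def field_simps)
  qed
  have u_lim: "(u \<longlongrightarrow> u 0) (at_right 0)"
    using DERIV_continuous[OF u_deriv0] by (simp add: continuous_within)
  have w_lim: "(w \<longlongrightarrow> c1) (at_right 0)"
  proof -
    have "(w \<longlongrightarrow> (p 0 + N 0) * u 0 / (2 * D 0)) (at_right 0)"
      unfolding w_def by (intro tendsto_intros u_lim has_fps_expansion_tendsto_at_right[OF p]
          has_fps_expansion_tendsto_at_right[OF N_expansion]
          has_fps_expansion_tendsto_at_right[OF D_expansion]) (simp add: D_0)
    then show ?thesis by (simp add: c1_def D_0)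
  qed
  obtain K where K: "eventually (\<lambda>r. \<bar>\<theta>\<^sub>1 r\<bar> \<le> K \<and> \<bar>\<theta>\<^sub>2 r\<bar> \<le> K \<and> \<bar>r\<bar> \<le> K \<and> \<bar>0::real\<bar> \<le> K) (at_right 0)"
    using coefficients_bounded by blast
  have "eventually (\<lambda>r. w r - W c1 c2 r = 0 \<and> u r - U c1 c2 r = 0) (at_right 0)"
  proof (rule linear_system_zero_at_right[OF _ K])
    show "eventually (\<lambda>r.
        ((\<lambda>r. w r - W c1 c2 r) has_real_derivative
          \<theta>\<^sub>1 r * (w r - W c1 c2 r) + \<theta>\<^sub>2 r * (u r - U c1 c2 r)) (at r) \<and>
        ((\<lambda>r. u r - U c1 c2 r) has_real_derivative
          r * (w r - W c1 c2 r) + 0 * (u r - U c1 c2 r)) (at r)) (at_right 0)"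
      using ev s_eq p_deriv eventually_regular
        eventually_at_right_if_nhds[OF W_deriv[of c1 c2]]
        eventually_at_right_if_nhds[OF U_deriv[of c1 c2]]
    proof eventually_elim
      case (elim r)
      have D: "D r \<noteq> 0" using regular_D_pos[OF elim(4)] by simp
      have u': "(u has_real_derivative r * w r) (at r)" using elim(1,2) by simp
      have "(w has_real_derivative
          (((- (r * (\<mu> r + p r) * (p r + N r)) / (2 * D r) + N' r) * u r
              + r * w r * (p r + N r)) * (2 * D r)
            - (p r + N r) * u r * (2 * (r * (N r - \<mu> r)))) / (2 * D r * (2 * D r))) (at r)"
        unfolding w_def[abs_def] using D
        by (auto intro!: derivative_eq_intros regular_D_deriv[OF elim(4)]
            regular_N_deriv[OF elim(4)] elim(3) u'[unfolded w_def])
      \<comment> \<open>The Riccati equation becomes linear here: u' = r w contributes r (p + N)^2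
        u/(2D), which cancels the term of the TOV equation quadratic in p.\<close>
      also have "(((- (r * (\<mu> r + p r) * (p r + N r)) / (2 * D r) + N' r) * u r
              + r * w r * (p r + N r)) * (2 * D r)
            - (p r + N r) * u r * (2 * (r * (N r - \<mu> r)))) / (2 * D r * (2 * D r))
          = \<theta>\<^sub>1 r * w r + \<theta>\<^sub>2 r * u r"
        unfolding w_def \<theta>\<^sub>1_def \<theta>\<^sub>2_def by (rule tov_derivative_identity[OF D])
      finally have w': "(w has_real_derivative \<theta>\<^sub>1 r * w r + \<theta>\<^sub>2 r * u r) (at r)" .
      show ?case
        using DERIV_diff[OF w' elim(5)] DERIV_diff[OF u' elim(6)] by (simp add: algebra_simps)
    qed
    show "((\<lambda>r. w r - W c1 c2 r) \<longlongrightarrow> 0) (at_right 0)"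
      using tendsto_diff[OF w_lim has_fps_expansion_tendsto_at_right[OF W_expansion[of c1 c2]]]
      by (simp add: W_0)
    show "((\<lambda>r. u r - U c1 c2 r) \<longlongrightarrow> 0) (at_right 0)"
      using tendsto_diff[OF u_lim has_fps_expansion_tendsto_at_right[OF U_expansion[of c1 c2]]]
      by (simp add: U_0 c2_def)
  qed
  then have eq: "eventually (\<lambda>r. w r = W c1 c2 r \<and> u r = U c1 c2 r) (at_right 0)"
    by simp
  have "eventually (\<lambda>r. u r = U c1 c2 r) (at_right 0)"
    using eq by (rule eventually_mono) simp
  moreover have "u 0 = U c1 c2 0"
    by (simp add: U_0 c2_def)
  ultimately have "(U c1 c2 has_real_derivative s 0) (at_right 0)"
    using u_deriv0 has_derivative_at_right_0_cong by blast
  \<comment> \<open>The one-sided derivative of \<open>U\<close> at 0 is unique, so it is both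
    \<open>s 0\<close> and 0.\<close>
  then have "s 0 = 0"
    unfolding has_field_derivative_iff
    by (rule tendsto_unique[OF trivial_limit_at_right_real _
          U_deriv_0[unfolded has_field_derivative_iff]])
  moreover have "eventually (\<lambda>r. s r = r * W c1 c2 r \<and> u r = U c1 c2 r \<and>
       A r = r * tov_phi \<mu> r * s r / (2 * u r) \<and>
       p r = 2 * D r * W c1 c2 r / U c1 c2 r - N r) (at_right 0)"
    using eq s_eq ev eventually_regular
  proof eventually_elim
    case (elim r)
    have "u r \<noteq> 0" using elim(3) by simp
    then have q: "p r + N r = 2 * D r * w r / u r"
      using regular_D_pos[OF elim(4)] by (simp add: w_def)
    have A: "A r = (p r + N r) / tov_phi \<mu> r" using elim(3) by simp
    have "A r = r * tov_phi \<mu> r * s r / (2 * u r)"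
      unfolding A q elim(2) using regular_div_phi[OF elim(4), of "w r / u r"] by simp
    moreover have "p r = 2 * D r * w r / u r - N r" using q by linarith
    ultimately show ?case
      using elim(1,2) by simp
  qed
  ultimately show ?thesis
    unfolding solution_formula_iff using u0 by (simp add: c1_def c2_def)
qed

section \<open>The central pressure and the existence of solutions\<close>

lemma central_pressure:
  assumes c2: "c2 \<noteq> 0" and p: "real_analytic_at_0 p"
    and formula: "solution_formula \<mu> T c1 c2 p A u s"
  shows "p 0 = 2 * c1 / c2 - \<mu> 0 / 3"
proof -
  have "((\<lambda>r. 2 * D r * W c1 c2 r / U c1 c2 r - N r) \<longlongrightarrow>
      2 * D 0 * W c1 c2 0 / U c1 c2 0 - N 0) (at_right 0)"
    using c2 by (intro tendsto_intros has_fps_expansion_tendsto_at_right[OF N_expansion]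
        has_fps_expansion_tendsto_at_right[OF D_expansion]
        has_fps_expansion_tendsto_at_right[OF W_expansion]
        has_fps_expansion_tendsto_at_right[OF U_expansion]) (simp add: U_0)
  moreover have "eventually (\<lambda>r. 2 * D r * W c1 c2 r / U c1 c2 r - N r = p r) (at_right 0)"
    using formula unfolding solution_formula_iff by (auto elim: eventually_mono)
  ultimately have "(p \<longlongrightarrow> 2 * D 0 * W c1 c2 0 / U c1 c2 0 - N 0) (at_right 0)"
    using Lim_transform_eventually by blast
  \<comment> \<open>The formula constrains p for r > 0 only; analyticity of p identifies its value
    at 0 with the limit.\<close>
  moreover have "(p \<longlongrightarrow> p 0) (at_right 0)"
    using p has_fps_expansion_tendsto_at_right unfolding real_analytic_at_0_def by blast
  ultimately show ?thesis
    using tendsto_unique[of "at_right (0::real)"] by (fastforce simp: D_0 W_0 U_0 N_0)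
qed

text \<open>For c2 nonzero, \<open>U_fps\<close> has nonzero constant coefficient, hence is a unit,
  and the quotient defining p is again analytic.\<close>

lemma formula_exists:
  assumes c2: "c2 \<noteq> 0"
  shows "\<exists>p A u s. real_analytic_at_0 p \<and> solution_formula \<mu> T c1 c2 p A u s"
proof -
  define p where "p r = 2 * D r * W c1 c2 r / U c1 c2 r - N r" for r
  define s where "s r = r * W c1 c2 r" for r
  have "p has_fps_expansion 2 * D_fps * W_fps c1 c2 / U_fps c1 c2 - mean_density_fps"
    unfolding p_def[abs_def]
    using c2 has_fps_expansion_at_0[OF U_expansion[of c1 c2]]
    by (intro fps_expansion_intros D_expansion N_expansion W_expansion U_expansion) (simp add: U_0)
  moreover have "solution_formula \<mu> T c1 c2 p
      (\<lambda>r. r * tov_phi \<mu> r * s r / (2 * U c1 c2 r)) (U c1 c2) s"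
    unfolding solution_formula_iff by (simp add: U_0 s_def p_def)
  ultimately show ?thesis
    unfolding real_analytic_at_0_def by blast
qed

text \<open>The defining relation reads u'/u = 2A/(r phi) = r (p + N)/(2D), an analytic function g.
  The exponential of its antiderivative vanishing at 0 is nonzero everywhere and equals 1 at
  0.\<close>

lemma tov_variables_exist:
  assumes p: "real_analytic_at_0 p"
  shows "\<exists>A u s. tov_variables \<mu> p A u s \<and> u 0 = 1"
proof -
  obtain P where P: "p has_fps_expansion P"
    using p unfolding real_analytic_at_0_def by blast
  define g where "g r = r * (p r + N r) / (2 * D r)" for r
  define G where "G = fps_X * (P + mean_density_fps) / (2 * D_fps)"
  have g: "g has_fps_expansion G"
    unfolding g_def[abs_def] G_def
    by (intro fps_expansion_intros P N_expansion D_expansion) (simp add: D_fps_0)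
  define h where "h = eval_fps (fps_integral0 G)"
  have h: "h has_fps_expansion fps_integral0 G"
    unfolding h_def using g fps_conv_radius_integral_ge[of G 0]
    by (intro eval_fps_has_fps_expansion) (auto simp: has_fps_expansion_def)
  define u where "u r = exp (h r)" for r
  define s where "s r = g r * u r" for r
  have "eventually (\<lambda>r. eval_fps G r = g r) (nhds 0)"
    using g by (simp add: has_fps_expansion_def)
  with has_fps_expansion_has_real_derivative[OF h]
  have u_deriv: "eventually (\<lambda>r. (u has_real_derivative s r) (at r)) (nhds 0)"
  proof eventually_elim
    case (elim r)
    then show ?case
      unfolding u_def[abs_def] s_def
      by (auto intro!: derivative_eq_intros simp: fps_deriv_fps_integral)
  qed
  have "tov_variables \<mu> p (\<lambda>r. (p r + N r) / tov_phi \<mu> r) u s"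
    unfolding tov_variables_iff
  proof (intro conjI)
    show "u 0 \<noteq> 0" by (simp add: u_def)
    show "(u has_real_derivative s 0) (at_right 0)"
      using eventually_nhds_x_imp_x[OF u_deriv] by (rule has_field_derivative_at_within)
    show "eventually (\<lambda>r. u r \<noteq> 0 \<and> (u has_real_derivative s r) (at r) \<and>
       (p r + N r) / tov_phi \<mu> r = (p r + N r) / tov_phi \<mu> r \<and>
       2 * D r * s r = r * (p r + N r) * u r) (at_right 0)"
      using eventually_at_right_if_nhds[OF u_deriv] eventually_regular
    proof eventually_elim
      case (elim r)
      then show ?case
        using regular_D_pos[OF elim(2)] by (simp add: s_def g_def u_def)
    qed
  qed
  moreover have "u 0 = 1"
    by (simp add: u_def h_def eval_fps_at_0)
  ultimately show ?thesis by blast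
qed

lemma P_series_summable:
  "\<exists>\<rho>>0. \<forall>r::real. \<bar>r\<bar> < \<rho> \<longrightarrow> summable (\<lambda>m. r ^ m *\<^sub>R P_coeff T m)"
  using P_series_sums_nhds unfolding eventually_nhds_metric
  by (auto simp: dist_real_def sums_iff)

text \<open>One direction is \<open>central_pressure\<close> with c2 = 1. For the other, a u with
  u(0) = 1 is constructed, and uniqueness then forces c1 = (p(0) + N(0))/2, where N(0) =
  mu(0)/3.\<close>

lemma central_pressure_characterization:
  assumes sol: "tov_analytic_solution \<mu> p"
  shows "(\<exists>A u s. solution_formula \<mu> T c1 1 p A u s) \<longleftrightarrow> c1 = 1 / 6 * (3 * p 0 + \<mu> 0)"
proof
  have p: "real_analytic_at_0 p"
    using sol by (simp add: tov_analytic_solution_def)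
  show "c1 = 1 / 6 * (3 * p 0 + \<mu> 0)" if "\<exists>A u s. solution_formula \<mu> T c1 1 p A u s"
    using that central_pressure[OF _ p] by fastforce
  show "\<exists>A u s. solution_formula \<mu> T c1 1 p A u s" if c1: "c1 = 1 / 6 * (3 * p 0 + \<mu> 0)"
  proof -
    obtain A u s where "tov_variables \<mu> p A u s" and u: "u 0 = 1"
      using tov_variables_exist[OF p] by blast
    then have "solution_formula \<mu> T ((p 0 + N 0) * u 0 / 2) (u 0) p A u s"
      using tov_imp_formula[OF sol] by blast
    moreover have "(p 0 + N 0) * u 0 / 2 = c1"
      by (simp add: c1 u N_0)
    ultimately show ?thesis
      using u by auto
  qed
qed

end

theorem mainTheorem4:
  fixes \<mu> :: "real \<Rightarrow> real"
  assumes "real_analytic_at_0 \<mu>"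
  shows "\<exists>T :: nat \<Rightarrow> real^2^2.
      Theta_power_series \<mu> T \<and>
      (\<exists>\<rho>>0. \<forall>r::real. \<bar>r\<bar> < \<rho> \<longrightarrow> summable (\<lambda>m. r ^ m *\<^sub>R P_coeff T m)) \<and>
      (\<forall>p A u s. real_analytic_at_0 p \<longrightarrow>
         (tov_analytic_solution \<mu> p \<and> tov_variables \<mu> p A u s \<longleftrightarrow>
            (\<exists>c1 c2. c2 \<noteq> 0 \<and> solution_formula \<mu> T c1 c2 p A u s))) \<and>
      (\<forall>c1 c2. c2 \<noteq> 0 \<longrightarrow>
         (\<exists>p A u s. tov_analytic_solution \<mu> p \<and> tov_variables \<mu> p A u s \<and>
            solution_formula \<mu> T c1 c2 p A u s)) \<and>
      (\<forall>p c1. tov_analytic_solution \<mu> p \<longrightarrow>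
         ((\<exists>A u s. solution_formula \<mu> T c1 1 p A u s) \<longleftrightarrow> c1 = 1 / 6 * (3 * p 0 + \<mu> 0)))"
proof -
  obtain F where "\<mu> has_fps_expansion F"
    using assms unfolding real_analytic_at_0_def by blast
  then interpret analytic_density \<mu> F
    by unfold_locales
  have "(tov_analytic_solution \<mu> p \<and> tov_variables \<mu> p A u s) \<longleftrightarrow>
      (\<exists>c1 c2. c2 \<noteq> 0 \<and> solution_formula \<mu> T c1 c2 p A u s)" if "real_analytic_at_0 p" for p A u s
    using formula_imp_tov[OF _ that] tov_imp_formula by meson
  moreover have "\<exists>p A u s. tov_analytic_solution \<mu> p \<and> tov_variables \<mu> p A u s \<and>
      solution_formula \<mu> T c1 c2 p A u s" if "c2 \<noteq> 0" for c1 c2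
    using formula_exists[OF that] formula_imp_tov[OF that] by meson
  ultimately show ?thesis
    using Theta_power_series_T P_series_summable central_pressure_characterization
    by (intro exI[of _ T] conjI allI impI) simp_all
qed

end
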